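(* Suppose the following four axioms hold. (1) $R$ is a set with a notion of convexity: every unordered pair $x,y\in R$ determines a subset $[x,y]\subset R$ of intermediate elements. (2) $A$ is a set, and for every ordered pair $(a,b)$ in $A$ there is a convex subset $R_{ab}\subset R$, interpreted as "the set of points whose distance from $a$ is no greater than their distance from $b$". (3) Put $H_{ab}=R_{ab}\cap R_{ba}$. If $x\in R_{ab}$ and $y\in R_{ba}$ then $[x,y]\cap H_{ab}\neq\emptyset$. (4) For all $a,b,c\in A$, $H_{ab}\cap R_{ac}=H_{ab}\cap R_{bc}$ and $H_{ab}\cap R_{ca}=H_{ab}\cap R_{cb}$. Let $\sigma=[a_0a_1\ldots a_p]$ be a simplex with vertices in $A$. Then: (a) $\sigma$ has a strong witness if and only if every subsimplex $\tau\le\sigma$ has a weak witness. (b) If for every nonempty $I\subseteq\{a_0,a_1,\ldots,a_p\}$ there exists a weak witness $x_I\in R$ for the subsimplex $\sigma_I\le\sigma$ with vertex set $I$, then the convex hull of the points $x_I$ contains a strong witness for $\sigma$.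
   Context: A subset $C\subset R$ is convex if it is closed under taking intermediate elements, i.e. $[x,y]\subset C$ whenever $x,y\in C$; the convex hull of a subset of $R$ is the intersection of all convex subsets of $R$ containing it. A simplex $\sigma=[a_0\ldots a_p]$ with vertices in $A$ (where $p\ge 0$) is given by a set of $p+1$ distinct elements $\{a_0,\ldots,a_p\}\subseteq A$; a subsimplex $\tau\le\sigma$ is a simplex whose vertex set is a nonempty subset of that of $\sigma$ (including $\sigma$ itself). A point $x\in R$ is a weak witness for $\sigma$ (with respect to $A$) if $x\in R_{ab}$ whenever $a\in\{a_0,\ldots,a_p\}$ and $b\in A\setminus\{a_0,\ldots,a_p\}$. It is a strong witness for $\sigma$ if it is a weak witness for $\sigma$ and additionally $x\in H_{a_ia_j}$ for all $i\neq j$ in $\{0,\ldots,p\}$.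
   Formalization: The formal theorem adds the hypothesis, suggested by the interpretation of R_ab as a distance comparison, that R is the union of R_ab and R_ba for all distinct a, b in A; with axioms (1)–(4) alone the claim fails, already for a set A of three elements and a set R of four points. *)

theory Defs
  imports Main "HOL.Hull"
begin

definition convex_in :: "'r set \<Rightarrow> ('r \<Rightarrow> 'r \<Rightarrow> 'r set) \<Rightarrow> 'r set \<Rightarrow> bool" where
  "convex_in R seg C \<longleftrightarrow> C \<subseteq> R \<and> (\<forall>x\<in>C. \<forall>y\<in>C. seg x y \<subseteq> C)"

definition bisector :: "('a \<Rightarrow> 'a \<Rightarrow> 'r set) \<Rightarrow> 'a \<Rightarrow> 'a \<Rightarrow> 'r set" where
  "bisector Rg a b = Rg a b \<inter> Rg b a"

text \<open>The interpretation of \<open>Rg a b\<close> as the set of points at least as close to \<open>a\<close> as to \<open>b\<close>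
  presupposes that any two such distances can be compared, so that \<open>Rg a b\<close> and \<open>Rg b a\<close>
  together exhaust \<open>R\<close>. This does not follow from the other axioms, and without it a simplex
  need not have a strong witness even if all its subsimplices have weak ones. For example, let
  \<open>A = {a, b, c}\<close>, let \<open>R\<close> consist of four points \<open>p, q, y, z\<close> with \<open>[p, q] = {p, q, y}\<close>
  and all other \<open>[u, v] = {u, v}\<close>, and let \<open>R_ab = {p, y}\<close>, \<open>R_ba = {q, y}\<close>,
  \<open>R_ac = {p, z}\<close>, \<open>R_bc = {q, z}\<close>, \<open>R_ca = R_cb = {}\<close> and \<open>R_aa = R_bb = R_cc = R\<close>.
  Then \<open>p\<close>, \<open>q\<close>, \<open>z\<close> are weak witnesses for \<open>[a]\<close>, \<open>[b]\<close>, \<open>[ab]\<close>, but \<open>[ab]\<close> has no strong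
  witness.\<close>

definition distances_comparable :: "'r set \<Rightarrow> 'a set \<Rightarrow> ('a \<Rightarrow> 'a \<Rightarrow> 'r set) \<Rightarrow> bool" where
  "distances_comparable R A Rg \<longleftrightarrow> (\<forall>a\<in>A. \<forall>b\<in>A. a \<noteq> b \<longrightarrow> R \<subseteq> Rg a b \<union> Rg b a)"

text \<open>A simplex is identified with its vertex set, and its subsimplices with the nonempty
  subsets of that set.\<close>

definition simplex :: "'a set \<Rightarrow> 'a set \<Rightarrow> bool" where
  "simplex A \<sigma> \<longleftrightarrow> finite \<sigma> \<and> \<sigma> \<noteq> {} \<and> \<sigma> \<subseteq> A"

definition subsimplex :: "'a set \<Rightarrow> 'a set \<Rightarrow> bool" where
  "subsimplex \<tau> \<sigma> \<longleftrightarrow> \<tau> \<noteq> {} \<and> \<tau> \<subseteq> \<sigma>"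

definition weak_witness ::
  "'r set \<Rightarrow> 'a set \<Rightarrow> ('a \<Rightarrow> 'a \<Rightarrow> 'r set) \<Rightarrow> 'a set \<Rightarrow> 'r \<Rightarrow> bool" where
  "weak_witness R A Rg \<sigma> x \<longleftrightarrow> x \<in> R \<and> (\<forall>a\<in>\<sigma>. \<forall>b\<in>A - \<sigma>. x \<in> Rg a b)"

definition strong_witness ::
  "'r set \<Rightarrow> 'a set \<Rightarrow> ('a \<Rightarrow> 'a \<Rightarrow> 'r set) \<Rightarrow> 'a set \<Rightarrow> 'r \<Rightarrow> bool" where
  "strong_witness R A Rg \<sigma> x \<longleftrightarrow>
    weak_witness R A Rg \<sigma> x \<and> (\<forall>a\<in>\<sigma>. \<forall>b\<in>\<sigma>. a \<noteq> b \<longrightarrow> x \<in> bisector Rg a b)"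

end

(*
  Induction on the number of vertices. On the bisector of a and b these two vertices cannot be
  told apart by comparison with a third one, so there it suffices to find a strong witness for
  the simplex without b, relative to A - {b}. Its subsimplices do have weak witnesses on the
  bisector: for I without b, two suitable ones among the given weak witnesses for I, I \<union> {a},
  I \<union> {b} and (I - {a}) \<union> {b} lie on different sides of the bisector, and the segment between
  them crosses it at a weak witness for I.
*)
theory Submission
  imports Defs
begin

lemma convex_in_Int:
  assumes "convex_in R seg C" "convex_in R seg D"
  shows "convex_in R seg (C \<inter> D)"
  using assms unfolding convex_in_def by blast

text \<open>The convex set \<open>D\<close> containing \<open>S\<close> is what keeps the hull
  inside \<open>R\<close>: over an empty family the intersection defining \<open>hull\<close> would
  be the whole type. Closure under segments passes to any intersection.\<close>

lemma convex_in_hull: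
  assumes "convex_in R seg D" "S \<subseteq> D"
  shows "convex_in R seg (convex_in R seg hull S)"
proof -
  have "convex_in R seg hull S \<subseteq> D"
    by (rule hull_minimal[where S = "convex_in R seg", OF assms(2,1)])
  then have "convex_in R seg hull S \<subseteq> R"
    using assms(1) unfolding convex_in_def by blast
  moreover have "seg x y \<subseteq> convex_in R seg hull S"
    if "x \<in> convex_in R seg hull S" "y \<in> convex_in R seg hull S" for x y
    using that unfolding hull_def convex_in_def by blast
  ultimately show ?thesis
    unfolding convex_in_def by blast
qed

text \<open>A point of \<open>A\<close> outside \<open>\<tau>\<close> is either outside
  \<open>\<sigma>\<close>, where the weak condition for \<open>\<sigma>\<close> applies, or another
  vertex of \<open>\<sigma>\<close>, where the bisector condition does. This is the easy direction
  of (a).\<close>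

lemma strong_witness_imp_weak_witness_subsimplex:
  assumes "strong_witness R A Rg \<sigma> x" "subsimplex \<tau> \<sigma>"
  shows "weak_witness R A Rg \<tau> x"
proof -
  have "x \<in> Rg a b" if "a \<in> \<tau>" "b \<in> A - \<tau>" for a b
  proof -
    have "a \<in> \<sigma>" "a \<noteq> b" using that assms(2) unfolding subsimplex_def by auto
    then show ?thesis
      using assms(1) that unfolding strong_witness_def weak_witness_def bisector_def
      by (cases "b \<in> \<sigma>") auto
  qed
  then show ?thesis
    using assms(1) unfolding strong_witness_def weak_witness_def by auto
qed

locale bisected_space =
  fixes R :: "'r set"
    and seg :: "'r \<Rightarrow> 'r \<Rightarrow> 'r set"
    and A :: "'a set"
    and Rg :: "'a \<Rightarrow> 'a \<Rightarrow> 'r set"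
  assumes region_convex: "\<And>a b. a \<in> A \<Longrightarrow> b \<in> A \<Longrightarrow> convex_in R seg (Rg a b)"
    and comparable: "distances_comparable R A Rg"
    and seg_meets_bisector: "\<And>a b x y. a \<in> A \<Longrightarrow> b \<in> A \<Longrightarrow> x \<in> Rg a b \<Longrightarrow> y \<in> Rg b a
          \<Longrightarrow> seg x y \<inter> bisector Rg a b \<noteq> {}"
    and bisector_out: "\<And>a b c. a \<in> A \<Longrightarrow> b \<in> A \<Longrightarrow> c \<in> A
          \<Longrightarrow> bisector Rg a b \<inter> Rg a c = bisector Rg a b \<inter> Rg b c"
    and bisector_in: "\<And>a b c. a \<in> A \<Longrightarrow> b \<in> A \<Longrightarrow> c \<in> A
          \<Longrightarrow> bisector Rg a b \<inter> Rg c a = bisector Rg a b \<inter> Rg c b"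
begin

text \<open>Regions are convex, so a point of the segment inherits every comparison that both
  endpoints satisfy.\<close>

lemma bisector_cross:
  assumes "convex_in R seg C" "x \<in> C" "y \<in> C"
    and "a \<in> A" "b \<in> A" "x \<in> Rg a b" "y \<in> Rg b a"
  obtains z where "z \<in> C" "z \<in> bisector Rg a b"
    "\<And>d c. d \<in> A \<Longrightarrow> c \<in> A \<Longrightarrow> x \<in> Rg d c \<Longrightarrow> y \<in> Rg d c \<Longrightarrow> z \<in> Rg d c"
proof -
  obtain z where "z \<in> seg x y" "z \<in> bisector Rg a b"
    using seg_meets_bisector[OF assms(4-7)] by blast
  then show thesis
    using that[of z] assms(1-3) region_convex unfolding convex_in_def by blast
qed

lemma bisector_out_iff:
  assumes "z \<in> bisector Rg a b" "a \<in> A" "b \<in> A" "c \<in> A"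
  shows "z \<in> Rg a c \<longleftrightarrow> z \<in> Rg b c"
  using bisector_out[OF assms(2-4)] assms(1) by blast

lemma bisector_in_iff:
  assumes "z \<in> bisector Rg a b" "a \<in> A" "b \<in> A" "c \<in> A"
  shows "z \<in> Rg c a \<longleftrightarrow> z \<in> Rg c b"
  using bisector_in[OF assms(2-4)] assms(1) by blast

text \<open>In each case two of the given witnesses have a known side of the bisector, and they are
  opposite. A third has an unknown side; comparability settles it, and it is joined to whichever of
  the two lies across.\<close>

lemma weak_witness_on_bisector:
  assumes conv: "convex_in R seg C" and B: "B \<subseteq> A" "\<sigma> \<subseteq> B" "b \<in> B" "b \<notin> \<sigma>" "a \<in> \<sigma>"
    and weak: "\<And>I. subsimplex I (insert b \<sigma>) \<Longrightarrow> \<exists>x\<in>C. weak_witness R B Rg I x"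
    and I: "subsimplex I \<sigma>"
  shows "\<exists>z\<in>C \<inter> bisector Rg a b. weak_witness R (B - {b}) Rg I z"
proof -
  have ab: "a \<in> A" "b \<in> A" "a \<in> B" "a \<noteq> b" using B by auto
  have I': "I \<noteq> {}" "I \<subseteq> \<sigma>" "b \<notin> I" "I \<subseteq> B" "I \<subseteq> A"
    using I B unfolding subsimplex_def by auto
  have sides: "x \<in> Rg a b \<or> x \<in> Rg b a" if "x \<in> R" for x
    using that comparable ab unfolding distances_comparable_def by blast
  have CR: "C \<subseteq> R" using conv unfolding convex_in_def by blast
  obtain x where x: "x \<in> C" "weak_witness R B Rg I x"
    using weak[of I] I' unfolding subsimplex_def by blast
  obtain y where y: "y \<in> C" "weak_witness R B Rg (insert b I) y"
    using weak[of "insert b I"] I' unfolding subsimplex_def by blast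
  show ?thesis
  proof (cases "a \<in> I")
    case aI: True
    \<comment> \<open>Trading \<open>a\<close> for \<open>b\<close> forces \<open>v\<close> onto the
      side of \<open>b\<close>, opposite \<open>x\<close>; the undetermined point is
      \<open>y\<close>.\<close>
    obtain v where v: "v \<in> C" "weak_witness R B Rg (insert b (I - {a})) v"
      using weak[of "insert b (I - {a})"] I' unfolding subsimplex_def by blast
    have xab: "x \<in> Rg a b" and vba: "v \<in> Rg b a"
      using x v aI I' ab B unfolding weak_witness_def by auto
    show ?thesis
    proof (cases "y \<in> Rg a b")
      case True
      obtain z where z: "z \<in> C" "z \<in> bisector Rg a b"
        and zin: "\<And>d c. d \<in> A \<Longrightarrow> c \<in> A \<Longrightarrow> y \<in> Rg d c \<Longrightarrow> v \<in> Rg d c \<Longrightarrow> z \<in> Rg d c"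
        using bisector_cross[OF conv y(1) v(1) ab(1,2) True vba] by blast
      have "z \<in> Rg d c" if "d \<in> I" "c \<in> B - {b} - I" for d c
      proof -
        \<comment> \<open>The simplex of \<open>v\<close> lacks \<open>a\<close>, so only the
          vertices other than \<open>a\<close> are covered directly. The comparison of
          \<open>a\<close> with \<open>c\<close> is read off from that of \<open>b\<close>, as
          \<open>z\<close> is on the bisector.\<close>
        have "z \<in> Rg d' c" if "d' \<in> insert b (I - {a})" for d'
          using zin[of d' c] y(2) v(2) that \<open>c \<in> B - {b} - I\<close> aI I' B
          unfolding weak_witness_def by blast
        then show ?thesis
          using bisector_out_iff[OF z(2) ab(1,2), of c] that B by blast
      qed
      then show ?thesis using z CR unfolding weak_witness_def by blast
    next
      case False
      then have "y \<in> Rg b a" using sides y CR by blast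
      then obtain z where z: "z \<in> C" "z \<in> bisector Rg a b"
        and zin: "\<And>d c. d \<in> A \<Longrightarrow> c \<in> A \<Longrightarrow> x \<in> Rg d c \<Longrightarrow> y \<in> Rg d c \<Longrightarrow> z \<in> Rg d c"
        using bisector_cross[OF conv x(1) y(1) ab(1,2) xab] by blast
      have "z \<in> Rg d c" if "d \<in> I" "c \<in> B - {b} - I" for d c
        using zin[of d c] x(2) y(2) that I' B unfolding weak_witness_def by blast
      then show ?thesis using z CR unfolding weak_witness_def by blast
    qed
  next
    case aI: False
    \<comment> \<open>Each of \<open>y\<close> and \<open>u\<close> witnesses a simplex with exactly
      one of \<open>a\<close> and \<open>b\<close>, which fixes its side; here \<open>x\<close> is
      undetermined.\<close>
    obtain u where u: "u \<in> C" "weak_witness R B Rg (insert a I) u"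
      using weak[of "insert a I"] I' B unfolding subsimplex_def by blast
    have yba: "y \<in> Rg b a" and uab: "u \<in> Rg a b"
      using y u aI I' ab B unfolding weak_witness_def by auto
    show ?thesis
    proof (cases "x \<in> Rg a b")
      case True
      obtain z where z: "z \<in> C" "z \<in> bisector Rg a b"
        and zin: "\<And>d c. d \<in> A \<Longrightarrow> c \<in> A \<Longrightarrow> x \<in> Rg d c \<Longrightarrow> y \<in> Rg d c \<Longrightarrow> z \<in> Rg d c"
        using bisector_cross[OF conv x(1) y(1) ab(1,2) True yba] by blast
      have "z \<in> Rg d c" if "d \<in> I" "c \<in> B - {b} - I" for d c
        using zin[of d c] x(2) y(2) that I' B unfolding weak_witness_def by blast
      then show ?thesis using z CR unfolding weak_witness_def by blast
    next
      case False
      then have "x \<in> Rg b a" using sides x CR by blast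
      then obtain z where z: "z \<in> C" "z \<in> bisector Rg a b"
        and zin: "\<And>d c. d \<in> A \<Longrightarrow> c \<in> A \<Longrightarrow> u \<in> Rg d c \<Longrightarrow> x \<in> Rg d c \<Longrightarrow> z \<in> Rg d c"
        using bisector_cross[OF conv u(1) x(1) ab(1,2) uab] by blast
      have "z \<in> Rg d c" if "d \<in> I" "c \<in> B - {b} - I" for d c
      proof -
        \<comment> \<open>Since \<open>a\<close> belongs to the simplex of \<open>u\<close>, nothing
          is known there about \<open>d\<close> against \<open>a\<close>. The range of
          \<open>c'\<close> includes \<open>b\<close>, and on the bisector the comparison with
          \<open>b\<close> yields the one with \<open>a\<close>.\<close>
        have "z \<in> Rg d c'" if "c' \<in> B - {a} - I" for c'
          using zin[of d c'] u(2) x(2) that \<open>d \<in> I\<close> I' B unfolding weak_witness_def by blast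
        then show ?thesis
          using bisector_in_iff[OF z(2) ab(1,2), of d] that I' B ab by blast
      qed
      then show ?thesis using z CR unfolding weak_witness_def by blast
    qed
  qed
qed

text \<open>On the bisector all comparisons of \<open>b\<close> with third points are copies of
  those of \<open>a\<close>, so restoring \<open>b\<close> both as a vertex and as an ambient point
  costs nothing.\<close>

lemma strong_witness_insert:
  assumes B: "B \<subseteq> A" "\<sigma> \<subseteq> B" "b \<in> B" "b \<notin> \<sigma>" "a \<in> \<sigma>"
    and w: "w \<in> bisector Rg a b" "strong_witness R (B - {b}) Rg \<sigma> w"
  shows "strong_witness R B Rg (insert b \<sigma>) w"
proof -
  have ab: "a \<in> A" "b \<in> A" using B by auto
  have out: "w \<in> Rg d c" if "d \<in> \<sigma>" "c \<in> B - insert b \<sigma>" for d c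
    using w(2) that unfolding strong_witness_def weak_witness_def by blast
  have inner: "w \<in> Rg d c" if "d \<in> \<sigma>" "c \<in> \<sigma>" "d \<noteq> c" for d c
    using w(2) that unfolding strong_witness_def bisector_def by blast
  have "w \<in> R"
    using w(2) unfolding strong_witness_def weak_witness_def by blast
  moreover have "w \<in> Rg b c" if "c \<in> B - insert b \<sigma>" for c
    using bisector_out_iff[OF w(1) ab, of c] out[OF B(5) that] that B by blast
  moreover have "w \<in> Rg b c \<and> w \<in> Rg c b" if "c \<in> \<sigma>" for c
  \<comment> \<open>For \<open>c = a\<close> there is no comparison of \<open>a\<close> with a
    distinct vertex to copy; the bisector itself gives the claim.\<close>
  proof (cases "c = a")
    case True
    then show ?thesis using w(1) unfolding bisector_def by blast
  next
    case False
    then show ?thesis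
      using bisector_out_iff[OF w(1) ab, of c] bisector_in_iff[OF w(1) ab, of c]
        inner[of a c] inner[of c a] that B by blast
  qed
  ultimately show ?thesis
    using out inner unfolding strong_witness_def weak_witness_def bisector_def by blast
qed

text \<open>Both \<open>B\<close> and \<open>C\<close> vary in the induction: removing the vertex
  \<open>b\<close> shrinks them to \<open>B - {b}\<close> and to the part of \<open>C\<close> on the
  bisector, which is again convex.\<close>

lemma strong_witness_in_convex:
  assumes "finite \<sigma>" "\<sigma> \<noteq> {}" "\<sigma> \<subseteq> B" "B \<subseteq> A" "convex_in R seg C"
    and "\<And>I. subsimplex I \<sigma> \<Longrightarrow> \<exists>x\<in>C. weak_witness R B Rg I x"
  shows "\<exists>w\<in>C. strong_witness R B Rg \<sigma> w"
  using assms
proof (induction \<sigma> arbitrary: B C rule: finite_ne_induct)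
  case (singleton a)
  then obtain x where "x \<in> C" "weak_witness R B Rg {a} x"
    unfolding subsimplex_def by blast
  \<comment> \<open>With a single vertex the bisector condition is vacuous.\<close>
  then show ?case unfolding strong_witness_def by blast
next
  case (insert b \<sigma>)
  obtain a where a: "a \<in> \<sigma>" using insert.hyps by blast
  have sub: "B \<subseteq> A" "\<sigma> \<subseteq> B" "b \<in> B" "a \<in> A" "b \<in> A"
    using insert.prems a by auto
  have "convex_in R seg (C \<inter> bisector Rg a b)"
    unfolding bisector_def
    by (intro convex_in_Int insert.prems region_convex sub)
  moreover have "\<exists>z\<in>C \<inter> bisector Rg a b. weak_witness R (B - {b}) Rg I z"
    if "subsimplex I \<sigma>" for I
    by (rule weak_witness_on_bisector[OF insert.prems(3) sub(1-3) insert.hyps(3) a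
          insert.prems(4) that])
  moreover have "\<sigma> \<subseteq> B - {b}" "B - {b} \<subseteq> A"
    using sub insert.hyps by auto
  ultimately obtain w
    where "w \<in> C \<inter> bisector Rg a b" "strong_witness R (B - {b}) Rg \<sigma> w"
    using insert.IH[of "B - {b}" "C \<inter> bisector Rg a b"] by blast
  then show ?case
    using strong_witness_insert[OF sub(1-3) insert.hyps(3) a] by blast
qed

end

theorem mainTheorem3:
  fixes R :: "'r set"
    and seg :: "'r \<Rightarrow> 'r \<Rightarrow> 'r set"
    and A :: "'a set"
    and Rg :: "'a \<Rightarrow> 'a \<Rightarrow> 'r set"
    and \<sigma> :: "'a set"
  assumes seg_subset: "\<And>x y. x \<in> R \<Longrightarrow> y \<in> R \<Longrightarrow> seg x y \<subseteq> R"
    and seg_sym: "\<And>x y. x \<in> R \<Longrightarrow> y \<in> R \<Longrightarrow> seg x y = seg y x"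
    and region_convex: "\<And>a b. a \<in> A \<Longrightarrow> b \<in> A \<Longrightarrow> convex_in R seg (Rg a b)"
    and comparable: "distances_comparable R A Rg"
    and seg_meets_bisector: "\<And>a b x y. a \<in> A \<Longrightarrow> b \<in> A \<Longrightarrow> x \<in> Rg a b \<Longrightarrow> y \<in> Rg b a
          \<Longrightarrow> seg x y \<inter> bisector Rg a b \<noteq> {}"
    and bisector_out: "\<And>a b c. a \<in> A \<Longrightarrow> b \<in> A \<Longrightarrow> c \<in> A
          \<Longrightarrow> bisector Rg a b \<inter> Rg a c = bisector Rg a b \<inter> Rg b c"
    and bisector_in: "\<And>a b c. a \<in> A \<Longrightarrow> b \<in> A \<Longrightarrow> c \<in> A
          \<Longrightarrow> bisector Rg a b \<inter> Rg c a = bisector Rg a b \<inter> Rg c b"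
    and simplex: "simplex A \<sigma>"
  shows "((\<exists>x. strong_witness R A Rg \<sigma> x) \<longleftrightarrow>
           (\<forall>\<tau>. subsimplex \<tau> \<sigma> \<longrightarrow> (\<exists>x. weak_witness R A Rg \<tau> x)))
       \<and> (\<forall>x :: 'a set \<Rightarrow> 'r. (\<forall>I. subsimplex I \<sigma> \<longrightarrow> weak_witness R A Rg I (x I)) \<longrightarrow>
           (\<exists>w \<in> convex_in R seg hull (x ` {I. subsimplex I \<sigma>}). strong_witness R A Rg \<sigma> w))"
proof -
  interpret bisected_space R seg A Rg
    by (unfold_locales; fact region_convex comparable seg_meets_bisector bisector_out bisector_in)
  have convR: "convex_in R seg R"
    using seg_subset unfolding convex_in_def by blast
  have \<sigma>: "finite \<sigma>" "\<sigma> \<noteq> {}" "\<sigma> \<subseteq> A"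
    using simplex unfolding simplex_def by auto
  \<comment> \<open>With all of \<open>A\<close> as ambient set, taking \<open>R\<close> as the
    convex set gives (a), and taking the hull of the chosen witnesses gives (b).\<close>
  note strong = strong_witness_in_convex[OF \<sigma> subset_refl]
  have "\<exists>x. strong_witness R A Rg \<sigma> x"
    if "\<forall>\<tau>. subsimplex \<tau> \<sigma> \<longrightarrow> (\<exists>x. weak_witness R A Rg \<tau> x)"
    using strong[OF convR] that unfolding weak_witness_def by blast
  moreover have "\<exists>w \<in> convex_in R seg hull (x ` {I. subsimplex I \<sigma>}). strong_witness R A Rg \<sigma> w"
    if x: "\<forall>I. subsimplex I \<sigma> \<longrightarrow> weak_witness R A Rg I (x I)" for x
  proof (rule strong)
    show "convex_in R seg (convex_in R seg hull (x ` {I. subsimplex I \<sigma>}))"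
      using x by (intro convex_in_hull[OF convR]) (auto simp: weak_witness_def)
    show "\<exists>y \<in> convex_in R seg hull (x ` {I. subsimplex I \<sigma>}). weak_witness R A Rg I y"
      if "subsimplex I \<sigma>" for I
      using x that by (blast intro: hull_inc)
  qed
  ultimately show ?thesis
    by (intro conjI iffI allI impI) (auto intro: strong_witness_imp_weak_witness_subsimplex)
qed

end
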